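(* Let $M$ be an additive submonoid of $(\mathbb{Q},+)$ that is not a group. Then either $M$ or $-M := \{-x \mid x \in M\}$ is a Puiseux monoid.
   Context: A Puiseux monoid is an additive submonoid of $\mathbb{Q}_{\ge 0}$ (the nonnegative rational numbers), i.e., a subset of $\mathbb{Q}_{\ge 0}$ containing $0$ and closed under addition. *)

theory Defs
  imports Complex_Main "HOL-Algebra.Group"
begin

definition rat_add :: "rat monoid" where
  "rat_add = \<lparr>carrier = UNIV, mult = (+), one = 0\<rparr>"

definition nonneg_rat_add :: "rat monoid" where
  "nonneg_rat_add = rat_add\<lparr>carrier := {q. 0 \<le> q}\<rparr>"

definition puiseux_monoid :: "rat set \<Rightarrow> bool" where
  "puiseux_monoid P \<longleftrightarrow> submonoid P nonneg_rat_add"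

lemma puiseux_monoid_iff:
  "puiseux_monoid P \<longleftrightarrow>
     (\<forall>x\<in>P. 0 \<le> x) \<and> 0 \<in> P \<and> (\<forall>x\<in>P. \<forall>y\<in>P. x + y \<in> P)"
  by (auto simp: puiseux_monoid_def submonoid_def nonneg_rat_add_def rat_add_def)

end

theory Submission imports Defs begin

text \<open>If \<open>M\<close> contains a positive and a negative number, then every \<open>x \<in> M\<close> has some
  \<open>y \<in> M\<close> of opposite sign, and commensurability gives \<open>(n + 1) x + m y = 0\<close> with natural
  \<open>n\<close> and \<open>m\<close>. Hence \<open>- x = n x + m y \<in> M\<close>, so \<open>M\<close> is a group.\<close>

text \<open>The ratio \<open>- x / y\<close> is a positive rational \<open>p / q\<close>, and
  clearing denominators gives \<open>q * x + p * y = 0\<close>. Writing the first coefficient as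
  \<open>Suc n\<close> guarantees one copy of \<open>x\<close> to move across the equation.\<close>

lemma opposite_signs_commensurable:
  fixes x y :: rat
  assumes "x * y < 0"
  shows "\<exists>n m :: nat. of_nat (Suc n) * x + of_nat m * y = 0"
proof -
  have y: "y \<noteq> 0" and pos: "0 < - x / y"
    using assms by (auto simp: mult_less_0_iff zero_less_divide_iff divide_less_0_iff)
  obtain p q where pq: "quotient_of (- x / y) = (p, q)"
    by fastforce
  have q: "0 < q" and eq: "- x / y = of_int p / of_int q"
    using pq quotient_of_denom_pos quotient_of_div by blast+
  have p: "0 < p"
    using pos q unfolding eq by (simp add: zero_less_divide_iff)
  have "of_int q * x + of_int p * y = 0"
    using eq y q by (simp add: field_simps)
  \<comment> \<open>As \<open>0 < q\<close>, the truncated subtraction is exact and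
    \<open>n = nat q - 1\<close> is the witness.\<close>
  moreover have "(of_nat (Suc (nat q - 1)) :: rat) = of_int q"
    using q by simp
  moreover have "(of_nat (nat p) :: rat) = of_int p"
    using p by simp
  ultimately show ?thesis
    by metis
qed

lemma submonoid_rat_add_iff:
  "submonoid M rat_add \<longleftrightarrow> 0 \<in> M \<and> (\<forall>x\<in>M. \<forall>y\<in>M. x + y \<in> M)"
  by (auto simp: submonoid_def rat_add_def)

lemma submonoid_rat_add_of_nat_mult:
  assumes "submonoid M rat_add" "x \<in> M"
  shows "of_nat n * x \<in> M"
  using assms by (induction n) (auto simp: submonoid_rat_add_iff algebra_simps)

lemma submonoid_rat_add_uminus:
  assumes M: "submonoid M rat_add" and "x \<in> M" "y \<in> M" "x * y < 0"
  shows "- x \<in> M"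
proof -
  obtain n m :: nat where "of_nat (Suc n) * x + of_nat m * y = 0"
    using opposite_signs_commensurable \<open>x * y < 0\<close> by blast
  then have "- x = of_nat n * x + of_nat m * y"
    by (simp add: algebra_simps)
  then show ?thesis
    using M submonoid_rat_add_of_nat_mult \<open>x \<in> M\<close> \<open>y \<in> M\<close>
    by (simp add: submonoid_rat_add_iff)
qed

lemma group_rat_addI:
  assumes "submonoid M rat_add" "\<And>x. x \<in> M \<Longrightarrow> - x \<in> M"
  shows "group (rat_add\<lparr>carrier := M\<rparr>)"
proof (rule groupI)
  fix x
  assume "x \<in> carrier (rat_add\<lparr>carrier := M\<rparr>)"
  then have "- x \<in> M"
    using assms(2) by simp
  then show "\<exists>y\<in>carrier (rat_add\<lparr>carrier := M\<rparr>).
      y \<otimes>\<^bsub>rat_add\<lparr>carrier := M\<rparr>\<^esub> x = \<one>\<^bsub>rat_add\<lparr>carrier := M\<rparr>\<^esub>"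
    by (intro bexI[of _ "- x"]) (simp_all add: rat_add_def)
\<comment> \<open>The hypothesis on \<open>M\<close> is rewritten first, while
  \<open>rat_add\<close> is still folded and \<open>submonoid_rat_add_iff\<close> can match.\<close>
qed (use assms(1) in \<open>simp_all add: submonoid_rat_add_iff, simp_all add: rat_add_def\<close>)

theorem proposition3p2:
  fixes M :: "rat set"
  assumes "submonoid M rat_add"
    and "\<not> group (rat_add\<lparr>carrier := M\<rparr>)"
  shows "puiseux_monoid M \<or> puiseux_monoid {- x | x. x \<in> M}"
proof -
  have "(\<forall>x\<in>M. 0 \<le> x) \<or> (\<forall>x\<in>M. x \<le> 0)"
  proof (rule ccontr)
    assume "\<not> ?thesis"
    then obtain a b where ab: "a \<in> M" "a < 0" "b \<in> M" "0 < b"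
      by (auto simp: not_le)
    have "- x \<in> M" if "x \<in> M" for x
    \<comment> \<open>The partner of opposite sign is \<open>b\<close> for negative \<open>x\<close>
      and \<open>a\<close> for positive \<open>x\<close>; zero is its own negative.\<close>
    proof (cases x "0 :: rat" rule: linorder_cases)
      case less
      then show ?thesis
        using submonoid_rat_add_uminus[OF assms(1) that ab(3)] ab by (simp add: mult_neg_pos)
    next
      case equal
      then show ?thesis
        using that by simp
    next
      case greater
      then show ?thesis
        using submonoid_rat_add_uminus[OF assms(1) that ab(1)] ab by (simp add: mult_pos_neg)
    qed
    then show False
      using group_rat_addI assms by blast
  qed
  then show ?thesis
  proof
    assume "\<forall>x\<in>M. 0 \<le> x"
    then show ?thesis
      using assms(1) by (simp add: puiseux_monoid_iff submonoid_rat_add_iff)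
  next
    assume "\<forall>x\<in>M. x \<le> 0"
    \<comment> \<open>Negation is additive, so it carries closure under addition from
      \<open>M\<close> to the reflected set.\<close>
    moreover have "- x + - y \<in> {- x | x. x \<in> M}" if "x \<in> M" "y \<in> M" for x y
    proof -
      have "- x + - y = - (x + y)" "x + y \<in> M"
        using that assms(1) by (simp_all add: submonoid_rat_add_iff)
      then show ?thesis
        by blast
    qed
    moreover have "0 \<in> {- x | x. x \<in> M}"
      using assms(1) by (auto simp: submonoid_rat_add_iff)
    ultimately have "puiseux_monoid {- x | x. x \<in> M}"
      unfolding puiseux_monoid_iff by auto
    then show ?thesis ..
  qed
qed

end
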